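(* For every $\omega\in\Omega$, the process $X$ is positive almost everywhere on $[0,\infty)$ (i.e. $X_t>0$ for Lebesgue-almost every $t\ge0$). Moreover, $$\{t\ge 0:\ X_t\le 0\}=\{t\ge 0:\ X_t=0\},$$ so the process $X$ is nonnegative on $[0,\infty)$.
   Context: Fix $H\in(0,\tfrac12)$ and constants $X_0>0$, $a>0$, $b\ge 0$, $\sigma>0$. $B^H=\{B^H_t,\ t\ge 0\}$ is a fractional Brownian motion with Hurst parameter $H$ on a complete probability space $(\Omega,\mathcal{F},\mathbb{P})$, i.e. a mean zero Gaussian process with covariance $\mathbb{E}(B^H_tB^H_s)=\frac12(t^{2H}+s^{2H}-|t-s|^{2H})$. A version is fixed such that, for every $\omega\in\Omega$, $B^H_0(\omega)=0$ and the trajectory $t\mapsto B^H_t(\omega)$ is continuous and, on each interval $[0,T]$ and for each $\gamma\in(0,H)$, Hölder continuous of order $H-\gamma$; all pathwise statements are for an arbitrary fixed $\omega\in\Omega$. For $\varepsilon>0$, $X^\varepsilon=\{X^\varepsilon_t\}$ denotes the unique continuous process satisfying, for all $t\ge0$, $$X^\varepsilon_t=X_0+a\int_0^t\frac{(s+\varepsilon)^{2H-1}}{X^\varepsilon_s\mathbf{1}_{\{X^\varepsilon_s>0\}}+\varepsilon}\,ds-b\int_0^tX^\varepsilon_s\,ds+\sigma B^H_t.$$ For each $t\ge 0$, $X^\varepsilon_t$ is monotone in $\varepsilon$ (nondecreasing as $\varepsilon$ decreases) and bounded above uniformly in $\varepsilon$, and the process $X=\{X_t,\ t\ge0\}$ is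 defined by the finite pointwise limit $X_t=\lim_{\varepsilon\downarrow 0}X^\varepsilon_t$. *)

theory Defs
  imports "HOL-Probability.Probability"
begin

text \<open>
  Degenerate normal laws (point masses) have to be admitted: a fractional Brownian motion
  vanishes at time 0, and linear combinations of its values may be constant.
\<close>

definition gaussian_rv :: "'w measure \<Rightarrow> ('w \<Rightarrow> real) \<Rightarrow> bool" where
  "gaussian_rv M Y \<longleftrightarrow> Y \<in> borel_measurable M \<and>
     (\<exists>\<mu> s. distr M borel Y = return borel \<mu> \<or>
            (0 < s \<and> distr M borel Y = density lborel (normal_density \<mu> s)))"

definition gaussian_process :: "'w measure \<Rightarrow> 'i set \<Rightarrow> ('i \<Rightarrow> 'w \<Rightarrow> real) \<Rightarrow> bool" where
  "gaussian_process M T Z \<longleftrightarrow>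
     (\<forall>I c. finite I \<and> I \<subseteq> T \<longrightarrow> gaussian_rv M (\<lambda>\<omega>. \<Sum>t\<in>I. c t * Z t \<omega>))"

text \<open>
  Processes have the real line as their index type; only the times \<open>t \<ge> 0\<close> are constrained.
\<close>

definition fractional_brownian_motion ::
    "'w measure \<Rightarrow> real \<Rightarrow> (real \<Rightarrow> 'w \<Rightarrow> real) \<Rightarrow> bool" where
  "fractional_brownian_motion M H B \<longleftrightarrow>
     gaussian_process M {0..} B \<and>
     (\<forall>t\<ge>0. integral\<^sup>L M (B t) = 0) \<and>
     (\<forall>t\<ge>0. \<forall>s\<ge>0. integral\<^sup>L M (\<lambda>\<omega>. B t \<omega> * B s \<omega>) =
        (t powr (2 * H) + s powr (2 * H) - \<bar>t - s\<bar> powr (2 * H)) / 2)"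

definition holder_on :: "real set \<Rightarrow> real \<Rightarrow> (real \<Rightarrow> real) \<Rightarrow> bool" where
  "holder_on S \<alpha> f \<longleftrightarrow> (\<exists>C. \<forall>s\<in>S. \<forall>t\<in>S. \<bar>f t - f s\<bar> \<le> C * \<bar>t - s\<bar> powr \<alpha>)"

definition regular_fbm_path :: "real \<Rightarrow> (real \<Rightarrow> real) \<Rightarrow> bool" where
  "regular_fbm_path H \<beta> \<longleftrightarrow>
     \<beta> 0 = 0 \<and> continuous_on {0..} \<beta> \<and>
     (\<forall>T>0. \<forall>\<gamma>. 0 < \<gamma> \<and> \<gamma> < H \<longrightarrow> holder_on {0..T} (H - \<gamma>) \<beta>)"

text \<open>
  The path \<open>x\<close> is a continuous solution of the \<open>\<epsilon>\<close>-regularised equation driven by the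
  path \<open>\<beta>\<close>. For \<open>\<epsilon> > 0\<close> both integrands are continuous on \<open>[0,t]\<close>, so that the
  integrals are genuine.
\<close>

definition approx_solution ::
    "real \<Rightarrow> real \<Rightarrow> real \<Rightarrow> real \<Rightarrow> real \<Rightarrow> real \<Rightarrow> (real \<Rightarrow> real) \<Rightarrow> (real \<Rightarrow> real) \<Rightarrow> bool" where
  "approx_solution H X0 a b \<sigma> \<epsilon> \<beta> x \<longleftrightarrow>
     continuous_on {0..} x \<and>
     (\<forall>t\<ge>0. x t = X0
        + a * integral {0..t} (\<lambda>s. (s + \<epsilon>) powr (2 * H - 1) / (x s * indicator {0<..} (x s) + \<epsilon>))
        - b * integral {0..t} x
        + \<sigma> * \<beta> t)"

end

theory Submission
  imports Defs
begin

text \<open>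
  The argument is pathwise and compares increments of the regularised solutions \<open>x\<^sub>\<epsilon>\<close> after a last
  crossing time of a level. Above the level \<open>X0\<close> the singular drift is bounded independently of
  \<open>\<epsilon>\<close>, so \<open>x\<^sub>\<epsilon>\<close> and hence the integrated drift are bounded uniformly in \<open>\<epsilon>\<close>. The drift blows up
  as \<open>\<epsilon> \<rightarrow> 0\<close> wherever the limit is nonpositive, so Fatou's lemma makes this set null. Below
  the level \<open>0\<close> the drift is of order \<open>1/\<epsilon>\<close>, so an excursion lasts at most a time of order
  \<open>\<epsilon>\<close>, during which the noise moves by \<open>o(1)\<close>; so the limit cannot be negative.
\<close>

section \<open>The regularised drift and increments of the equation\<close>

text \<open>The factor \<open>a\<close> is left out. The truncation uses \<open>max\<close>, which
  is visibly continuous, in place of the indicator in \<open>approx_solution\<close>; the two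
  denominators agree for every value of \<open>x s\<close>.\<close>

definition singular_drift :: "real \<Rightarrow> real \<Rightarrow> (real \<Rightarrow> real) \<Rightarrow> real \<Rightarrow> real" where
  "singular_drift H \<epsilon> x s = (s + \<epsilon>) powr (2 * H - 1) / (max (x s) 0 + \<epsilon>)"

lemma singular_drift_nonneg: "\<epsilon> > 0 \<Longrightarrow> singular_drift H \<epsilon> x s \<ge> 0"
  by (simp add: singular_drift_def)

lemma continuous_on_singular_drift:
  assumes "\<epsilon> > 0" "continuous_on {0..} x"
  shows "continuous_on {0..} (singular_drift H \<epsilon> x)"
  unfolding singular_drift_def
proof (intro continuous_intros assms ballI)
  show "max (x s) 0 + \<epsilon> \<noteq> 0" for s using assms(1) by linarith
  show "s + \<epsilon> \<noteq> 0" if "s \<in> {0..}" for s using assms(1) that by simp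
qed

lemma singular_drift_integrable:
  assumes "\<epsilon> > 0" "continuous_on {0..} x" "0 \<le> s"
  shows "singular_drift H \<epsilon> x integrable_on {s..t}"
  using assms by (intro integrable_continuous_real continuous_on_subset[OF continuous_on_singular_drift]) auto

lemma approx_solution_continuous:
  "approx_solution H X0 a b \<sigma> \<epsilon> \<beta> x \<Longrightarrow> continuous_on {0..} x"
  by (simp add: approx_solution_def)

lemma approx_solution_eq:
  assumes "approx_solution H X0 a b \<sigma> \<epsilon> \<beta> x" "t \<ge> 0"
  shows "x t = X0 + a * integral {0..t} (singular_drift H \<epsilon> x) - b * integral {0..t} x + \<sigma> * \<beta> t"
proof -
  have "(\<lambda>s. (s + \<epsilon>) powr (2 * H - 1) / (x s * indicator {0<..} (x s) + \<epsilon>)) = singular_drift H \<epsilon> x"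
    by (auto simp: singular_drift_def fun_eq_iff indicator_def max_def)
  then show ?thesis using assms by (simp add: approx_solution_def)
qed

text \<open>Restarting the equation at an intermediate time is what allows a comparison from a
  crossing time onwards.\<close>

lemma approx_solution_increment:
  assumes sol: "approx_solution H X0 a b \<sigma> \<epsilon> \<beta> x" and "\<epsilon> > 0" "0 \<le> s" "s \<le> t"
  shows "x t - x s = a * integral {s..t} (singular_drift H \<epsilon> x) - b * integral {s..t} x + \<sigma> * (\<beta> t - \<beta> s)"
proof -
  note cont = approx_solution_continuous[OF sol]
  have drift: "integral {0..s} (singular_drift H \<epsilon> x) + integral {s..t} (singular_drift H \<epsilon> x)
      = integral {0..t} (singular_drift H \<epsilon> x)"
    using assms by (intro Henstock_Kurzweil_Integration.integral_combine singular_drift_integrable cont) auto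
  have path: "integral {0..s} x + integral {s..t} x = integral {0..t} x"
    using assms
    by (intro Henstock_Kurzweil_Integration.integral_combine integrable_continuous_real
        continuous_on_subset[OF cont]) auto
  show ?thesis
    using approx_solution_eq[OF sol, of t] approx_solution_eq[OF sol, of s] assms
    unfolding drift[symmetric] path[symmetric] by (simp add: algebra_simps)
qed

section \<open>Last crossing times\<close>

text \<open>The times in \<open>{0..t}\<close> at which \<open>f\<close> is at least
  \<open>c\<close> form a nonempty compact set, so there is a last one.\<close>

lemma last_crossing_down:
  fixes f :: "real \<Rightarrow> real"
  assumes cont: "continuous_on {0..t} f" and "0 \<le> t" and "c \<le> f 0" and "f t \<le> c"
  obtains \<tau> where "0 \<le> \<tau>" "\<tau> \<le> t" "f \<tau> = c" "\<And>s. \<tau> \<le> s \<Longrightarrow> s \<le> t \<Longrightarrow> f s \<le> c"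
proof -
  define S where "S = {s \<in> {0..t}. c \<le> f s}"
  have "closed S" unfolding S_def
    by (rule continuous_on_closed_Collect_le) (auto intro: cont)
  moreover have "bounded S"
    by (rule bounded_subset[OF bounded_closed_interval[of 0 t]]) (auto simp: S_def)
  ultimately have "compact S" by (simp add: compact_eq_bounded_closed)
  moreover have "S \<noteq> {}" using assms by (auto simp: S_def)
  ultimately obtain \<tau> where \<tau>: "\<tau> \<in> S" "\<forall>s\<in>S. s \<le> \<tau>"
    using compact_attains_sup[of S] by auto
  have \<tau>_range: "0 \<le> \<tau>" "\<tau> \<le> t" "c \<le> f \<tau>" using \<tau>(1) by (auto simp: S_def)
  have "continuous_on {\<tau>..t} f" using \<tau>_range by (intro continuous_on_subset[OF cont]) auto
  \<comment> \<open>The intermediate value theorem gives a time \<open>u\<close> from \<tau> on with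
    value exactly \<open>c\<close>; it lies in \<open>S\<close>, so \<open>u\<close> equals \<tau>
    by maximality.\<close>
  then obtain u where u: "\<tau> \<le> u" "u \<le> t" "f u = c"
    using IVT2'[of f t c \<tau>] \<tau>_range assms by blast
  then have "u \<le> \<tau>" using \<tau>(2) \<tau>_range by (simp add: S_def)
  with u have \<tau>_eq: "f \<tau> = c" by simp
  have "f s \<le> c" if "\<tau> \<le> s" "s \<le> t" for s
  proof (rule ccontr)
    assume *: "\<not> f s \<le> c"
    then have "s \<le> \<tau>" using \<tau>(2) \<tau>_range that by (simp add: S_def)
    then show False using * \<tau>_eq that by simp
  qed
  with \<tau>_range \<tau>_eq show ?thesis using that by blast
qed

lemma last_crossing_up:
  fixes f :: "real \<Rightarrow> real"
  assumes "continuous_on {0..t} f" and "0 \<le> t" and "f 0 \<le> c" and "c \<le> f t"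
  obtains \<tau> where "0 \<le> \<tau>" "\<tau> \<le> t" "f \<tau> = c" "\<And>s. \<tau> \<le> s \<Longrightarrow> s \<le> t \<Longrightarrow> c \<le> f s"
proof -
  have "continuous_on {0..t} (\<lambda>s. - f s)" using assms(1) by (rule continuous_on_minus)
  then obtain \<tau> where "0 \<le> \<tau>" "\<tau> \<le> t" "- f \<tau> = - c" "\<And>s. \<tau> \<le> s \<Longrightarrow> s \<le> t \<Longrightarrow> - f s \<le> - c"
    by (rule last_crossing_down[of t "\<lambda>s. - f s" "- c"]) (use assms in auto)
  then show ?thesis by (intro that[of \<tau>]) simp_all
qed

section \<open>Bounds uniform in \<epsilon>\<close>

lemma continuous_path_bounded:
  fixes \<beta> :: "real \<Rightarrow> real"
  assumes "continuous_on {0..} \<beta>"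
  shows "\<exists>L. \<forall>t\<in>{0..T}. \<bar>\<beta> t\<bar> \<le> L"
proof -
  have "compact (\<beta> ` {0..T})"
    by (intro compact_continuous_image continuous_on_subset[OF assms]) auto
  then obtain L where "\<forall>y \<in> \<beta> ` {0..T}. norm y \<le> L"
    using compact_imp_bounded bounded_iff by blast
  then show ?thesis by auto
qed

text \<open>The antiderivative is \<open>(u + \<epsilon>) powr p / p\<close>, and its nonnegative
  value at \<open>s\<close> is dropped. With \<open>p = 2 * H > 0\<close> the bound stays finite as
  \<epsilon> tends to 0.\<close>

lemma integral_powr_bound:
  fixes \<epsilon> p :: real
  assumes "\<epsilon> > 0" "p > 0" "0 \<le> s" "s \<le> t"
  shows "((\<lambda>u. (u + \<epsilon>) powr (p - 1)) integrable_on {s..t})"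
    and "integral {s..t} (\<lambda>u. (u + \<epsilon>) powr (p - 1)) \<le> (t + \<epsilon>) powr p / p"
proof -
  have "((\<lambda>u. (u + \<epsilon>) powr (p - 1)) has_integral ((t + \<epsilon>) powr p / p - (s + \<epsilon>) powr p / p)) {s..t}"
    using assms
    by (intro fundamental_theorem_of_calculus)
      (auto intro!: derivative_eq_intros simp flip: has_real_derivative_iff_has_vector_derivative)
  then show "((\<lambda>u. (u + \<epsilon>) powr (p - 1)) integrable_on {s..t})"
    and "integral {s..t} (\<lambda>u. (u + \<epsilon>) powr (p - 1)) \<le> (t + \<epsilon>) powr p / p"
    using assms by (auto simp: has_integral_integrable integral_unique)
qed

text \<open>If \<open>x t\<close> exceeds \<open>X0\<close>, follow the path from its last crossing
  of that level: from there the denominator of the drift is at least \<open>X0\<close>, the damping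
  term only pushes down, and \<beta> moves by at most \<open>2 * L\<close>.\<close>

lemma approx_solution_upper_bound:
  assumes "0 < H" "X0 > 0" "a > 0" "b \<ge> 0" "\<sigma> > 0" "0 \<le> T"
    and "\<beta> 0 = 0" and bound: "\<forall>t\<in>{0..T}. \<bar>\<beta> t\<bar> \<le> L"
    and sol: "approx_solution H X0 a b \<sigma> \<epsilon> \<beta> x" and "0 < \<epsilon>" "\<epsilon> \<le> 1" "0 \<le> t" "t \<le> T"
  shows "x t \<le> X0 + a * ((T + 1) powr (2 * H) / (2 * H) / X0) + \<sigma> * (2 * L)"
proof (cases "x t \<le> X0")
  case True
  have "0 \<le> L" using bound assms(6,7) by force
  then show ?thesis using True assms by (simp add: add_increasing2)
next
  case False
  note cont = approx_solution_continuous[OF sol]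
  have "x 0 = X0" using approx_solution_eq[OF sol, of 0] assms by simp
  then obtain \<tau> where \<tau>: "0 \<le> \<tau>" "\<tau> \<le> t" "x \<tau> = X0" "\<And>s. \<tau> \<le> s \<Longrightarrow> s \<le> t \<Longrightarrow> X0 \<le> x s"
    using last_crossing_up[of t x X0] continuous_on_subset[OF cont] False \<open>0 \<le> t\<close> by auto
  have "integral {\<tau>..t} (singular_drift H \<epsilon> x) \<le> integral {\<tau>..t} (\<lambda>u. (u + \<epsilon>) powr (2 * H - 1) / X0)"
  proof (rule integral_le)
    show "singular_drift H \<epsilon> x u \<le> (u + \<epsilon>) powr (2 * H - 1) / X0" if "u \<in> {\<tau>..t}" for u
      unfolding singular_drift_def using \<tau>(4)[of u] that assms
      by (intro divide_left_mono) auto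
  qed (use \<tau> assms integral_powr_bound[of \<epsilon> "2 * H" \<tau> t] cont in
      \<open>auto intro: singular_drift_integrable integrable_on_divide\<close>)
  also have "\<dots> \<le> (t + \<epsilon>) powr (2 * H) / (2 * H) / X0"
    using divide_right_mono[OF integral_powr_bound(2)[of \<epsilon> "2 * H" \<tau> t], of X0] \<tau> assms by simp
  \<comment> \<open>Here \<open>\<epsilon> \<le> 1\<close> removes \<epsilon> from the bound; the
    power is increasing because its exponent is positive.\<close>
  also have "\<dots> \<le> (T + 1) powr (2 * H) / (2 * H) / X0"
    using assms by (intro divide_right_mono powr_mono2) auto
  finally have "a * integral {\<tau>..t} (singular_drift H \<epsilon> x) \<le> a * ((T + 1) powr (2 * H) / (2 * H) / X0)"
    using assms by (intro mult_left_mono) auto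
  moreover have "0 \<le> b * integral {\<tau>..t} x"
    using \<tau> assms
    by (intro mult_nonneg_nonneg integral_nonneg integrable_continuous_real
        continuous_on_subset[OF cont]) force+
  moreover have "\<bar>\<beta> t\<bar> \<le> L" "\<bar>\<beta> \<tau>\<bar> \<le> L"
    using bound \<tau>(1,2) \<open>t \<le> T\<close> by auto
  then have "\<sigma> * (\<beta> t - \<beta> \<tau>) \<le> \<sigma> * (2 * L)"
    using \<open>\<sigma> > 0\<close> by (intro mult_left_mono) linarith+
  ultimately show ?thesis
    using approx_solution_increment[OF sol \<open>0 < \<epsilon>\<close> \<tau>(1,2)] \<tau>(3) by linarith
qed

text \<open>Solve the equation at time \<open>T\<close> for the integrated drift. Since
  \<open>b \<ge> 0\<close>, only upper bounds on the path enter the estimate, together with the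
  bound on the noise.\<close>

lemma integral_singular_drift_bounded:
  assumes "0 < H" "X0 > 0" "a > 0" "b \<ge> 0" "\<sigma> > 0" "0 \<le> T"
    and "\<beta> 0 = 0" and \<beta>: "continuous_on {0..} \<beta>"
    and sol: "\<And>\<epsilon>. \<epsilon> > 0 \<Longrightarrow> approx_solution H X0 a b \<sigma> \<epsilon> \<beta> (x \<epsilon>)"
  shows "\<exists>C. \<forall>\<epsilon>\<in>{0<..1}. integral {0..T} (singular_drift H \<epsilon> (x \<epsilon>)) \<le> C"
proof -
  obtain L where L: "\<forall>t\<in>{0..T}. \<bar>\<beta> t\<bar> \<le> L"
    using continuous_path_bounded[OF \<beta>] by blast
  define K where "K = X0 + a * ((T + 1) powr (2 * H) / (2 * H) / X0) + \<sigma> * (2 * L)"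
  have "integral {0..T} (singular_drift H \<epsilon> (x \<epsilon>)) \<le> (K + b * (T * K) + \<sigma> * L) / a"
    if \<epsilon>: "0 < \<epsilon>" "\<epsilon> \<le> 1" for \<epsilon>
  proof -
    have K: "x \<epsilon> t \<le> K" if "0 \<le> t" "t \<le> T" for t
      unfolding K_def using approx_solution_upper_bound[OF assms(1-7) L sol] \<epsilon> that by auto
    have "integral {0..T} (x \<epsilon>) \<le> integral {0..T} (\<lambda>_. K)"
      using K \<epsilon> by (intro integral_le integrable_continuous_real
          continuous_on_subset[OF approx_solution_continuous[OF sol]]) auto
    then have "b * integral {0..T} (x \<epsilon>) \<le> b * (T * K)"
      using assms by (intro mult_left_mono) auto
    moreover have "\<sigma> * (- \<beta> T) \<le> \<sigma> * L"
      using bspec[OF L, of T] assms by (intro mult_left_mono) auto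
    ultimately have "a * integral {0..T} (singular_drift H \<epsilon> (x \<epsilon>)) \<le> K + b * (T * K) + \<sigma> * L"
      using approx_solution_eq[OF sol, of \<epsilon> T] K[of T] \<epsilon> assms by simp
    then show ?thesis using assms by (simp add: field_simps)
  qed
  then show ?thesis by (intro exI ballI) auto
qed

section \<open>Positivity almost everywhere\<close>

text \<open>The numerator tends to the positive number \<open>s powr (2 * H - 1)\<close>, while the
  denominator tends to \<open>max l 0 = 0\<close> through positive values.\<close>

lemma singular_drift_blowup:
  assumes "s > 0" and lim: "((\<lambda>\<epsilon>. x \<epsilon> s) \<longlongrightarrow> l) (at_right 0)" and "l \<le> 0"
  shows "filterlim (\<lambda>\<epsilon>. singular_drift H \<epsilon> (x \<epsilon>) s) at_top (at_right 0)"
proof -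
  have id0: "((\<lambda>\<epsilon>. \<epsilon>) \<longlongrightarrow> (0::real)) (at_right 0)" by (rule tendsto_ident_at)
  have num: "((\<lambda>\<epsilon>. (s + \<epsilon>) powr (2 * H - 1)) \<longlongrightarrow> (s + 0) powr (2 * H - 1)) (at_right 0)"
    using assms by (intro tendsto_intros id0) auto
  have "((\<lambda>\<epsilon>. max (x \<epsilon> s) 0 + \<epsilon>) \<longlongrightarrow> max l 0 + 0) (at_right 0)"
    by (intro tendsto_intros lim id0)
  moreover have "\<forall>\<^sub>F \<epsilon> in at_right 0. 0 < max (x \<epsilon> s) 0 + \<epsilon>"
    using eventually_at_right_less[of 0] by eventually_elim auto
  ultimately have den: "filterlim (\<lambda>\<epsilon>. max (x \<epsilon> s) 0 + \<epsilon>) (at_right 0) (at_right 0)"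
    using assms by (simp add: filterlim_at max_def eventually_conj_iff)
      (auto elim: eventually_mono)
  show ?thesis unfolding singular_drift_def
    using den assms
    by (intro LIM_at_top_divide[OF num]) (auto simp: filterlim_at elim: eventually_mono)
qed

text \<open>Fatou's lemma bounds the integral of the lower limit of the drifts, so this lower limit
  is finite almost everywhere; at a positive time with \<open>y t \<le> 0\<close> it would be
  infinite.\<close>

lemma limit_positive_AE:
  assumes "0 < H" "X0 > 0" "a > 0" "b \<ge> 0" "\<sigma> > 0"
    and "\<beta> 0 = 0" and "continuous_on {0..} \<beta>"
    and sol: "\<And>\<epsilon>. \<epsilon> > 0 \<Longrightarrow> approx_solution H X0 a b \<sigma> \<epsilon> \<beta> (x \<epsilon>)"
    and lim: "\<And>t. t \<ge> 0 \<Longrightarrow> ((\<lambda>\<epsilon>. x \<epsilon> t) \<longlongrightarrow> y t) (at_right 0)"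
  shows "AE t in lborel. t \<ge> 0 \<longrightarrow> y t > 0"
proof -
  \<comment> \<open>Fatou's lemma concerns sequences, so \<epsilon> runs through 1, 1/2, 1/3, ...,
    all within the range of the uniform drift bound.\<close>
  define e where "e n = inverse (real (Suc n))" for n
  have e: "0 < e n" "e n \<le> 1" for n by (auto simp: e_def divide_simps)
  have e_lim: "filterlim e (at_right 0) sequentially"
    unfolding e_def filterlim_at using LIMSEQ_inverse_real_of_nat by auto
  have "AE t in lborel. 0 < t \<and> t \<le> T \<longrightarrow> y t > 0" if T: "0 \<le> T" for T
  proof -
    define d where "d n s = ennreal (singular_drift H (e n) (x (e n)) s) * indicator {0..T} s" for n s
    obtain C where C: "\<forall>\<epsilon>\<in>{0<..1}. integral {0..T} (singular_drift H \<epsilon> (x \<epsilon>)) \<le> C"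
      using integral_singular_drift_bounded[OF assms(1-5) T assms(6,7) sol] by blast
    have cont: "continuous_on {0..T} (singular_drift H (e n) (x (e n)))" for n
      using e by (intro continuous_on_subset[OF continuous_on_singular_drift]
          approx_solution_continuous[OF sol]) auto
    have d_eq: "d n s = ennreal (indicator {0..T} s *\<^sub>R singular_drift H (e n) (x (e n)) s)" for n s
      by (simp add: d_def indicator_def)
    have d_meas [measurable]: "d n \<in> borel_measurable lborel" for n
      unfolding d_eq[abs_def]
      using borel_measurable_continuous_on_indicator[OF _ cont[of n]] by measurable
    have "(\<integral>\<^sup>+ s. d n s \<partial>lborel) \<le> ennreal C" for n
    proof -
      have "(singular_drift H (e n) (x (e n)) has_integral
          integral {0..T} (singular_drift H (e n) (x (e n)))) {0..T}"
        using cont by (intro integrable_integral integrable_continuous_real)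
      from nn_integral_has_integral_lebesgue'[OF singular_drift_nonneg[OF e(1)] this]
      have "(\<integral>\<^sup>+ s. d n s \<partial>lborel) = ennreal (integral {0..T} (singular_drift H (e n) (x (e n))))"
        by (simp only: d_def)
      then show ?thesis using C e by (simp add: ennreal_leI)
    qed
    then have "liminf (\<lambda>n. \<integral>\<^sup>+ s. d n s \<partial>lborel) \<le> ennreal C"
      by (intro Liminf_le always_eventually allI) simp_all
    with nn_integral_liminf[of d lborel, OF d_meas]
    have "(\<integral>\<^sup>+ s. liminf (\<lambda>n. d n s) \<partial>lborel) \<le> ennreal C"
      by (rule order_trans)
    then have "(\<integral>\<^sup>+ s. liminf (\<lambda>n. d n s) \<partial>lborel) \<noteq> \<infinity>"
      by (auto simp: top_unique)
    then have "AE s in lborel. liminf (\<lambda>n. d n s) \<noteq> \<infinity>"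
      by (intro nn_integral_PInf_AE) measurable
    then show ?thesis
    proof eventually_elim
      case (elim s)
      have "y s > 0" if s: "0 < s" "s \<le> T"
      proof (rule ccontr)
        assume "\<not> y s > 0"
        then have "filterlim (\<lambda>\<epsilon>. singular_drift H \<epsilon> (x \<epsilon>) s) at_top (at_right 0)"
          using s lim[of s] by (intro singular_drift_blowup) auto
        from filterlim_compose[OF this e_lim]
        have "(\<lambda>n. ennreal (singular_drift H (e n) (x (e n)) s)) \<longlonglongrightarrow> \<infinity>"
          by (simp add: ennreal_tendsto_top_eq_at_top)
        then have "(\<lambda>n. d n s) \<longlonglongrightarrow> \<infinity>"
          using s by (simp add: d_def)
        from lim_imp_Liminf[OF _ this] show False using elim by simp
      qed
      then show ?case by simp
    qed
  qed
  \<comment> \<open>Countably many bounded horizons exhaust the positive times, so their exceptional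
    null sets can be united.\<close>
  then have "AE t in lborel. \<forall>n::nat. 0 < t \<and> t \<le> real n \<longrightarrow> y t > 0"
    by (simp only: AE_all_countable of_nat_0_le_iff simp_thms)
  \<comment> \<open>The blow-up argument covers positive times only. At time 0 the integrals and the
    noise vanish, so every regularised path starts at \<open>X0\<close>.\<close>
  moreover have y0: "y 0 = X0"
  proof (rule tendsto_unique[OF _ lim[of 0]])
    show "((\<lambda>\<epsilon>. x \<epsilon> 0) \<longlongrightarrow> X0) (at_right 0)"
    proof (rule tendsto_eventually)
      show "\<forall>\<^sub>F \<epsilon> in at_right 0. x \<epsilon> 0 = X0"
        using eventually_at_right_less[of 0]
      proof eventually_elim
        case (elim \<epsilon>)
        then show ?case using approx_solution_eq[OF sol[OF elim], of 0] \<open>\<beta> 0 = 0\<close> by simp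
      qed
    qed
  qed auto
  ultimately show ?thesis
  proof eventually_elim
    case (elim t)
    obtain n :: nat where "t \<le> real n" using real_arch_simple by blast
    with elim y0 \<open>X0 > 0\<close> show ?case by (cases "t = 0") auto
  qed
qed

section \<open>Nonnegativity of the limit\<close>

text \<open>Let \<tau> be the last time up to \<open>t\<close> at level 0. From there to
  \<open>t\<close> the denominator of the drift is exactly \<epsilon>, and the damping term pushes
  up. As the path ends below 0, the noise must outweigh the drift, which limits the length of the
  excursion.\<close>

lemma approx_solution_lower_bound:
  assumes "H < 1/2" "X0 > 0" "a > 0" "b \<ge> 0" "\<sigma> > 0" "0 \<le> t"
    and "\<beta> 0 = 0" and bound: "\<forall>s\<in>{0..t}. \<bar>\<beta> s\<bar> \<le> L"
    and sol: "approx_solution H X0 a b \<sigma> \<epsilon> \<beta> x" and "0 < \<epsilon>" "\<epsilon> \<le> 1" and "x t < 0"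
  obtains \<tau> where "0 \<le> \<tau>" "\<tau> \<le> t" "a * (t + 1) powr (2 * H - 1) * (t - \<tau>) \<le> \<epsilon> * (\<sigma> * (2 * L))"
    "\<sigma> * (\<beta> t - \<beta> \<tau>) \<le> x t"
proof -
  note cont = approx_solution_continuous[OF sol]
  have "x 0 = X0" using approx_solution_eq[OF sol, of 0] assms by simp
  then obtain \<tau> where \<tau>: "0 \<le> \<tau>" "\<tau> \<le> t" "x \<tau> = 0" "\<And>s. \<tau> \<le> s \<Longrightarrow> s \<le> t \<Longrightarrow> x s \<le> 0"
    using last_crossing_down[of t x 0] continuous_on_subset[OF cont] assms by auto
  \<comment> \<open>A lower bound for the drift on the excursion:
    \<open>s + \<epsilon> \<le> t + 1\<close>, and the exponent is negative because
    \<open>H < 1/2\<close>.\<close>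
  define c where "c = (t + 1) powr (2 * H - 1) / \<epsilon>"
  have "integral {\<tau>..t} (\<lambda>_. c) \<le> integral {\<tau>..t} (singular_drift H \<epsilon> x)"
  proof (rule integral_le)
    show "c \<le> singular_drift H \<epsilon> x s" if "s \<in> {\<tau>..t}" for s
      unfolding c_def singular_drift_def using that \<tau>(1) \<tau>(4)[of s] assms
      by (auto simp: max_absorb2 intro!: divide_right_mono powr_mono2')
  qed (use \<tau> assms cont in \<open>auto intro: singular_drift_integrable\<close>)
  then have drift: "a * (c * (t - \<tau>)) \<le> a * integral {\<tau>..t} (singular_drift H \<epsilon> x)"
    using \<tau> assms by (simp add: mult.commute)
  have "integral {\<tau>..t} x \<le> integral {\<tau>..t} (\<lambda>_. 0)"
    using \<tau> by (intro integral_le integrable_continuous_real continuous_on_subset[OF cont]) auto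
  then have "b * integral {\<tau>..t} x \<le> 0"
    using assms by (intro mult_nonneg_nonpos) auto
  with drift have *: "a * (c * (t - \<tau>)) + \<sigma> * (\<beta> t - \<beta> \<tau>) \<le> x t"
    using approx_solution_increment[OF sol, of \<tau> t] \<tau> assms by linarith
  have "\<bar>\<beta> t\<bar> \<le> L" "\<bar>\<beta> \<tau>\<bar> \<le> L"
    using bound \<tau>(1,2) by auto
  then have "\<sigma> * (\<beta> \<tau> - \<beta> t) \<le> \<sigma> * (2 * L)"
    using \<open>\<sigma> > 0\<close> by (intro mult_left_mono) linarith+
  with * have "a * (c * (t - \<tau>)) \<le> \<sigma> * (2 * L)"
    using \<open>x t < 0\<close> by (simp add: algebra_simps)
  then have "\<epsilon> * (a * (c * (t - \<tau>))) \<le> \<epsilon> * (\<sigma> * (2 * L))"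
    using assms by (intro mult_left_mono) auto
  then have "a * (t + 1) powr (2 * H - 1) * (t - \<tau>) \<le> \<epsilon> * (\<sigma> * (2 * L))"
    using assms by (simp add: c_def)
  \<comment> \<open>Dropping this nonnegative push from \<open>*\<close> leaves the inequality for
    the noise alone.\<close>
  moreover have "0 \<le> a * (c * (t - \<tau>))" using \<tau> assms by (simp add: c_def)
  ultimately show ?thesis using that \<tau> * by force
qed

text \<open>If \<open>l < 0\<close>, the excursions below 0 that end at \<open>t\<close> become
  arbitrarily short as \<epsilon> tends to 0, yet \<beta> has to drop by more than
  \<open>- l / (2 * \<sigma>)\<close> during each of them; this contradicts its continuity at
  \<open>t\<close>.\<close>

lemma limit_nonneg:
  assumes "H < 1/2" "X0 > 0" "a > 0" "b \<ge> 0" "\<sigma> > 0" "0 \<le> t"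
    and "\<beta> 0 = 0" and \<beta>: "continuous_on {0..} \<beta>"
    and sol: "\<And>\<epsilon>. \<epsilon> > 0 \<Longrightarrow> approx_solution H X0 a b \<sigma> \<epsilon> \<beta> (x \<epsilon>)"
    and lim: "((\<lambda>\<epsilon>. x \<epsilon> t) \<longlongrightarrow> l) (at_right 0)"
  shows "l \<ge> 0"
proof (rule ccontr)
  assume "\<not> l \<ge> 0"
  obtain L where L: "\<forall>s\<in>{0..t}. \<bar>\<beta> s\<bar> \<le> L"
    using continuous_path_bounded[OF \<beta>] by blast
  \<comment> \<open>The factor 2 leaves room for convergence: for small \<epsilon> the path at
    \<open>t\<close> is only known to lie below \<open>l / 2\<close>.\<close>
  have "0 < - l / (2 * \<sigma>)" using \<open>\<not> l \<ge> 0\<close> assms by (simp add: divide_neg_pos)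
  then obtain \<delta> where "\<delta> > 0"
    and \<delta>: "\<And>s. s \<ge> 0 \<Longrightarrow> dist s t < \<delta> \<Longrightarrow> dist (\<beta> s) (\<beta> t) < - l / (2 * \<sigma>)"
    using \<beta> \<open>0 \<le> t\<close> unfolding continuous_on_iff by (metis atLeast_iff)
  define k where "k = a * (t + 1) powr (2 * H - 1)"
  have "k > 0" using assms by (simp add: k_def)
  have "((\<lambda>\<epsilon>. \<epsilon> * (\<sigma> * (2 * L))) \<longlongrightarrow> 0 * (\<sigma> * (2 * L))) (at_right 0)"
    by (intro tendsto_intros)
  then have "\<forall>\<^sub>F \<epsilon> in at_right 0. \<epsilon> * (\<sigma> * (2 * L)) < k * \<delta>"
    using \<open>k > 0\<close> \<open>\<delta> > 0\<close> by (intro order_tendstoD(2)[where y = 0]) auto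
  moreover have "\<forall>\<^sub>F \<epsilon> in at_right 0. x \<epsilon> t < l / 2"
    using \<open>\<not> l \<ge> 0\<close> by (intro order_tendstoD(2)[OF lim]) auto
  moreover have "\<forall>\<^sub>F \<epsilon> in at_right 0. 0 < \<epsilon> \<and> \<epsilon> < (1::real)"
    by (rule eventually_at_rightI[of 0 1]) auto
  ultimately have "\<forall>\<^sub>F \<epsilon> in at_right 0. \<epsilon> * (\<sigma> * (2 * L)) < k * \<delta> \<and> x \<epsilon> t < l / 2 \<and> 0 < \<epsilon> \<and> \<epsilon> < 1"
    by eventually_elim auto
  then obtain \<epsilon> where small: "\<epsilon> * (\<sigma> * (2 * L)) < k * \<delta>" "x \<epsilon> t < l / 2" "0 < \<epsilon>" "\<epsilon> < 1"
    using eventually_happens trivial_limit_at_right_real by blast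
  then have "x \<epsilon> t < 0" using \<open>\<not> l \<ge> 0\<close> by simp
  with small obtain \<tau> where \<tau>: "0 \<le> \<tau>" "\<tau> \<le> t" "k * (t - \<tau>) \<le> \<epsilon> * (\<sigma> * (2 * L))"
    "\<sigma> * (\<beta> t - \<beta> \<tau>) \<le> x \<epsilon> t"
    using approx_solution_lower_bound[OF assms(1-7) L sol[OF small(3)] small(3)]
      small(4) unfolding k_def by auto
  then have "k * (t - \<tau>) < k * \<delta>" using small by linarith
  then have "dist \<tau> t < \<delta>" using \<tau> \<open>k > 0\<close> by (simp add: dist_real_def)
  then have "\<beta> \<tau> - \<beta> t < - l / (2 * \<sigma>)" using \<delta>[of \<tau>] \<tau> by (auto simp: dist_real_def)
  then have "\<sigma> * (\<beta> \<tau> - \<beta> t) < - l / 2" using assms by (simp add: field_simps)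
  then show False using small \<tau> by (simp add: algebra_simps)
qed

theorem corollary3p2:
  fixes M :: "'w measure"
    and H X0 a b \<sigma> :: real
    and B X :: "real \<Rightarrow> 'w \<Rightarrow> real"
    and X\<epsilon> :: "real \<Rightarrow> real \<Rightarrow> 'w \<Rightarrow> real"
  assumes "prob_space M" and "complete_measure M"
    and "0 < H" and "H < 1/2"
    and "X0 > 0" and "a > 0" and "b \<ge> 0" and "\<sigma> > 0"
    and "fractional_brownian_motion M H B"
    and "\<And>\<omega>. \<omega> \<in> space M \<Longrightarrow> regular_fbm_path H (\<lambda>t. B t \<omega>)"
    and "\<And>\<epsilon> \<omega>. \<epsilon> > 0 \<Longrightarrow> \<omega> \<in> space M \<Longrightarrow>
           approx_solution H X0 a b \<sigma> \<epsilon> (\<lambda>t. B t \<omega>) (\<lambda>t. X\<epsilon> \<epsilon> t \<omega>)"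
    and "\<And>t \<omega>. t \<ge> 0 \<Longrightarrow> \<omega> \<in> space M \<Longrightarrow>
           ((\<lambda>\<epsilon>. X\<epsilon> \<epsilon> t \<omega>) \<longlongrightarrow> X t \<omega>) (at_right 0)"
  shows "\<forall>\<omega>\<in>space M.
           (AE t in lebesgue. t \<ge> 0 \<longrightarrow> X t \<omega> > 0) \<and>
           {t. t \<ge> 0 \<and> X t \<omega> \<le> 0} = {t. t \<ge> 0 \<and> X t \<omega> = 0} \<and>
           (\<forall>t\<ge>0. X t \<omega> \<ge> 0)"
proof
  fix \<omega> assume \<omega>: "\<omega> \<in> space M"
  note path = assms(10)[OF \<omega>, unfolded regular_fbm_path_def]
  have "AE t in lebesgue. t \<ge> 0 \<longrightarrow> X t \<omega> > 0"
    \<comment> \<open>Lebesgue measure is the completion of \<open>lborel\<close>, so the almost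
      everywhere statement carries over.\<close>
    by (rule AE_completion, rule limit_positive_AE[OF assms(3,5-8) _ _ assms(11) assms(12)]) (use path \<omega> in auto)
  moreover have "X t \<omega> \<ge> 0" if "t \<ge> 0" for t
    by (rule limit_nonneg[OF assms(4-8) that _ _ assms(11) assms(12)]) (use path \<omega> that in auto)
  ultimately show "(AE t in lebesgue. t \<ge> 0 \<longrightarrow> X t \<omega> > 0) \<and>
           {t. t \<ge> 0 \<and> X t \<omega> \<le> 0} = {t. t \<ge> 0 \<and> X t \<omega> = 0} \<and>
           (\<forall>t\<ge>0. X t \<omega> \<ge> 0)"
    by (simp add: set_eq_iff) (metis order_antisym order_refl)
qed

end
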